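(* The superextension $\lambda(X)$ of a regular semigroup $X$ is supercommutative if and only if $X$ is isomorphic to one of the semigroups: $C_2$, $L_1\sqcup C_2$, $V_3$, or $L_n$ for some $n\in\mathbb N$.
   Context: $\mathbb N=\{1,2,3,\dots\}$. An upfamily on a nonempty set $X$ is a nonempty family $\mathcal F$ of nonempty subsets of $X$ such that $F\in\mathcal F$ and $F\subset E\subset X$ imply $E\in\mathcal F$; $\upsilon(X)$ is the set of all upfamilies on $X$. A family $\mathcal G$ of nonempty subsets of $X$ generates the upfamily $\langle G:G\in\mathcal G\rangle=\{E\subset X:\exists G\in\mathcal G,\ G\subset E\}$. An upfamily $\mathcal F$ is linked if $A\cap B\ne\emptyset$ for all $A,B\in\mathcal F$; it is maximal linked if it is linked and coincides with every linked upfamily containing it. $\lambda(X)$ (the superextension) is the set of maximal linked upfamilies. If $X$ is a semigroup, put for $\mathcal A,\mathcal B\in\upsilon(X)$: $\mathcal A*\mathcal B=\langle\bigcup_{a\in A}aB_a: A\in\mathcal A,\ (B_a)_{a\in A}\in\mathcal B^A\rangle$ and $\mathcal A\circledast\mathcal B=\langle AB:A\in\mathcal A,\ B\in\mathcal B\rangle$, where $AB=\{ab:a\in A,b\in B\}$. The operation $*$ is associative and $\lambda(X)$ is a subsemigroup of $(\upsilon(X),* )$; it is supercommutative if $\mathcal A*\mathcal B=\mathcal A\circledast\mathcal B=\mathcal B\circledast\mathcal A=\mathcal B*\mathcal A$ for all $\mathcal A,\mathcal B\in\lambda(X)$. A semigroup $X$ is regular if $x\in xXx$ for every $x\in X$.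 $C_n=\{z\in\mathbb C:z^n=1\}$ is the cyclic group of order $n$; $L_n=\{0,\dots,n-1\}$ is the linear semilattice with operation $\min$; $V_3=\{0,1\}^2\setminus\{(1,1)\}$ is the semilattice with the operation of coordinatewise minimum. For semigroups $(X,* )$ and $(Y,\star)$ the ordered union $X\sqcup Y$ is $X\times\{0\}\cup Y\times\{1\}$ with the operation $(a,0)\circ(b,0)=(a*b,0)$, $(a,0)\circ(b,1)=(a,0)$, $(a,1)\circ(b,0)=(b,0)$, $(a,1)\circ(b,1)=(a\star b,1)$. *)

theory Defs
  imports "HOL-Algebra.Coset" Complex_Main
begin

text \<open>
  Semigroups are rendered with the monoid records of \<open>HOL-Algebra\<close>, of which only the
  fields \<open>carrier\<close> and \<open>mult\<close> matter: neither the locale below nor \<open>hom\<close>, \<open>\<cong>\<close>, \<open><#\<close>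
  and \<open><#>\<close> look at \<open>one\<close>.
\<close>

locale carrier_semigroup =
  fixes X :: "('a, 'm) monoid_scheme" (structure)
  assumes nonempty: "carrier X \<noteq> {}"
    and m_closed: "\<lbrakk>x \<in> carrier X; y \<in> carrier X\<rbrakk> \<Longrightarrow> x \<otimes> y \<in> carrier X"
    and m_assoc: "\<lbrakk>x \<in> carrier X; y \<in> carrier X; z \<in> carrier X\<rbrakk>
      \<Longrightarrow> (x \<otimes> y) \<otimes> z = x \<otimes> (y \<otimes> z)"

locale regular_carrier_semigroup = carrier_semigroup +
  assumes regular: "x \<in> carrier X \<Longrightarrow> \<exists>y \<in> carrier X. x = x \<otimes> y \<otimes> x"

definition upfamily :: "'a set \<Rightarrow> 'a set set \<Rightarrow> bool" where
  "upfamily S \<F> \<longleftrightarrow> \<F> \<noteq> {} \<and> (\<forall>F\<in>\<F>. F \<noteq> {} \<and> F \<subseteq> S)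
     \<and> (\<forall>F E. F \<in> \<F> \<and> F \<subseteq> E \<and> E \<subseteq> S \<longrightarrow> E \<in> \<F>)"

definition generated_upfamily :: "'a set \<Rightarrow> 'a set set \<Rightarrow> 'a set set" where
  "generated_upfamily S \<G> = {E. E \<subseteq> S \<and> (\<exists>G\<in>\<G>. G \<subseteq> E)}"

definition linked :: "'a set set \<Rightarrow> bool" where
  "linked \<F> \<longleftrightarrow> (\<forall>A\<in>\<F>. \<forall>B\<in>\<F>. A \<inter> B \<noteq> {})"

definition maximal_linked :: "'a set \<Rightarrow> 'a set set \<Rightarrow> bool" where
  "maximal_linked S \<F> \<longleftrightarrow> upfamily S \<F> \<and> linked \<F>
     \<and> (\<forall>\<G>. upfamily S \<G> \<and> linked \<G> \<and> \<F> \<subseteq> \<G> \<longrightarrow> \<G> = \<F>)"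

definition superextension :: "'a set \<Rightarrow> 'a set set set" where
  "superextension S = {\<F>. maximal_linked S \<F>}"

definition upfamily_mult ::
    "('a, 'm) monoid_scheme \<Rightarrow> 'a set set \<Rightarrow> 'a set set \<Rightarrow> 'a set set" where
  "upfamily_mult X \<A> \<B> = generated_upfamily (carrier X)
     {\<Union>a\<in>A. a <#\<^bsub>X\<^esub> B a | A B. A \<in> \<A> \<and> (\<forall>a\<in>A. B a \<in> \<B>)}"

definition upfamily_setmult ::
    "('a, 'm) monoid_scheme \<Rightarrow> 'a set set \<Rightarrow> 'a set set \<Rightarrow> 'a set set" where
  "upfamily_setmult X \<A> \<B> = generated_upfamily (carrier X)
     {A <#>\<^bsub>X\<^esub> B | A B. A \<in> \<A> \<and> B \<in> \<B>}"

definition supercommutative_superextension :: "('a, 'm) monoid_scheme \<Rightarrow> bool" where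
  "supercommutative_superextension X \<longleftrightarrow>
     (\<forall>\<A> \<in> superextension (carrier X). \<forall>\<B> \<in> superextension (carrier X).
        upfamily_mult X \<A> \<B> = upfamily_setmult X \<A> \<B>
      \<and> upfamily_setmult X \<A> \<B> = upfamily_setmult X \<B> \<A>
      \<and> upfamily_setmult X \<B> \<A> = upfamily_mult X \<B> \<A>)"

definition semigroup_of :: "'a set \<Rightarrow> ('a \<Rightarrow> 'a \<Rightarrow> 'a) \<Rightarrow> 'a monoid" where
  "semigroup_of S f = \<lparr>carrier = S, mult = f, one = undefined\<rparr>"

definition cyclic_C :: "nat \<Rightarrow> complex monoid" where
  "cyclic_C n = semigroup_of {z. z ^ n = 1} (*)"

definition linear_L :: "nat \<Rightarrow> nat monoid" where
  "linear_L n = semigroup_of {0..<n} min"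

definition V3 :: "(nat \<times> nat) monoid" where
  "V3 = semigroup_of ({0, 1} \<times> {0, 1} - {(1, 1)}) (\<lambda>(a, b) (c, d). (min a c, min b d))"

text \<open>
  The disjoint union \<open>X \<times> {0} \<union> Y \<times> {1}\<close> is the sum of the carriers, so that \<open>X\<close> and \<open>Y\<close>
  may have different types: \<open>Inl a\<close> stands for \<open>(a, 0)\<close> and \<open>Inr b\<close> for \<open>(b, 1)\<close>.
\<close>

fun ordered_union_mult ::
    "('a, 'm) monoid_scheme \<Rightarrow> ('b, 'n) monoid_scheme \<Rightarrow> 'a + 'b \<Rightarrow> 'a + 'b \<Rightarrow> 'a + 'b" where
  "ordered_union_mult X Y (Inl a) (Inl b) = Inl (a \<otimes>\<^bsub>X\<^esub> b)"
| "ordered_union_mult X Y (Inl a) (Inr b) = Inl a"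
| "ordered_union_mult X Y (Inr a) (Inl b) = Inl b"
| "ordered_union_mult X Y (Inr a) (Inr b) = Inr (a \<otimes>\<^bsub>Y\<^esub> b)"

definition ordered_union ::
    "('a, 'm) monoid_scheme \<Rightarrow> ('b, 'n) monoid_scheme \<Rightarrow> ('a + 'b) monoid" where
  "ordered_union X Y = semigroup_of (carrier X <+> carrier Y) (ordered_union_mult X Y)"

end

(*
Principal upfamilies make X commutative. For a three-element set T, the sets containing at least
two elements of T form a maximal linked upfamily; equality of the two products on such families
says that a set meeting two rows of a 3 x 3 multiplication table in two cells each contains a
2 x 2 minor. Applied to well-chosen tables, this gives x^3 = x, at most one element that is not
idempotent (and then at most one further idempotent, which is a zero), and, for semilattices with
two incomparable elements a, b, that X = {ab, a, b}. What remains are chains; an infinite one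
contains a monotone sequence by Ramsey's theorem, and families extending its even and its odd tails
violate commutativity. Conversely, a maximal linked upfamily on a set with at most three elements is
principal or the two-out-of-three family, so the small semigroups are a finite check, and on a
finite chain a suitable choice of one c in A makes A B_c lie in the union of the sets a B_a.
*)
theory Submission
  imports Defs "HOL-Library.Ramsey"
begin

section \<open>Maximal linked upfamilies\<close>

lemma upfamilyD:
  assumes "upfamily S \<F>"
  shows "F \<in> \<F> \<Longrightarrow> F \<subseteq> S" "F \<in> \<F> \<Longrightarrow> F \<subseteq> E \<Longrightarrow> E \<subseteq> S \<Longrightarrow> E \<in> \<F>" "{} \<notin> \<F>"
  using assms unfolding upfamily_def by blast+

text \<open>A linked family that contains each set or its complement cannot grow: the complement of
  a new member would already be present and disjoint from it.\<close>

lemma maximal_linkedI: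
  assumes "upfamily S \<F>" "linked \<F>" "\<And>E. E \<subseteq> S \<Longrightarrow> E \<in> \<F> \<or> S - E \<in> \<F>"
  shows "maximal_linked S \<F>"
  unfolding maximal_linked_def
proof (intro conjI allI impI)
  fix \<G> assume G: "upfamily S \<G> \<and> linked \<G> \<and> \<F> \<subseteq> \<G>"
  have "E \<in> \<F>" if "E \<in> \<G>" for E
  proof (rule ccontr)
    assume "E \<notin> \<F>"
    moreover have "E \<subseteq> S" using G that upfamilyD(1) by blast
    ultimately have "S - E \<in> \<G>" using assms(3) G by blast
    then show False using G that unfolding linked_def by blast
  qed
  then show "\<G> = \<F>" using G by blast
qed (fact assms(1,2))+

text \<open>If neither set were a member, every member would meet \<open>E\<close>, since one
  avoiding \<open>E\<close> would put \<open>S - E\<close> into the upfamily. Adding all supersets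
  of \<open>E\<close> would then keep the family linked and contradict maximality.\<close>

lemma maximal_linked_compl:
  assumes "maximal_linked S \<F>" "E \<subseteq> S"
  shows "E \<in> \<F> \<or> S - E \<in> \<F>"
proof (rule ccontr)
  assume not: "\<not> ?thesis"
  have up: "upfamily S \<F>" and li: "linked \<F>"
    and max: "\<And>\<G>. upfamily S \<G> \<Longrightarrow> linked \<G> \<Longrightarrow> \<F> \<subseteq> \<G> \<Longrightarrow> \<G> = \<F>"
    using assms(1) by (auto simp: maximal_linked_def)
  have meet: "F \<inter> E \<noteq> {}" if "F \<in> \<F>" for F
  proof
    assume "F \<inter> E = {}"
    then have "F \<subseteq> S - E" using upfamilyD(1)[OF up that] by blast
    then have "S - E \<in> \<F>" using upfamilyD(2)[OF up that] by simp
    then show False using not by simp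
  qed
  obtain F0 where F0: "F0 \<in> \<F>" using up unfolding upfamily_def by blast
  define \<G> where "\<G> = \<F> \<union> {D. E \<subseteq> D \<and> D \<subseteq> S}"
  have "E \<noteq> {}" using meet[OF F0] by blast
  have "upfamily S \<G>"
    unfolding upfamily_def
  proof (intro conjI allI impI ballI)
    show "\<G> \<noteq> {}" using F0 by (auto simp: \<G>_def)
    fix F assume F: "F \<in> \<G>"
    then show "F \<noteq> {}" using meet \<open>E \<noteq> {}\<close> by (auto simp: \<G>_def)
    show "F \<subseteq> S" using F upfamilyD(1)[OF up] by (auto simp: \<G>_def)
  next
    fix F D assume "F \<in> \<G> \<and> F \<subseteq> D \<and> D \<subseteq> S"
    then show "D \<in> \<G>" using upfamilyD(2)[OF up, of F D] by (auto simp: \<G>_def)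
  qed
  moreover have "linked \<G>"
    unfolding linked_def
  proof (intro ballI)
    fix A B assume "A \<in> \<G>" "B \<in> \<G>"
    then consider "A \<in> \<F>" "B \<in> \<F>" | "A \<in> \<F>" "E \<subseteq> B" | "B \<in> \<F>" "E \<subseteq> A" | "E \<subseteq> A" "E \<subseteq> B"
      by (auto simp: \<G>_def)
    then show "A \<inter> B \<noteq> {}"
    proof cases
      case 1
      then show ?thesis using li unfolding linked_def by blast
    next
      case 2
      then show ?thesis using meet[of A] by blast
    next
      case 3
      then show ?thesis using meet[of B] by blast
    next
      case 4
      then show ?thesis using \<open>E \<noteq> {}\<close> by blast
    qed
  qed
  ultimately have "\<G> = \<F>" using max \<G>_def by blast
  then show False using not assms(2) by (auto simp: \<G>_def)
qed

text \<open>Zorn's lemma is applied to linked families that need not be upfamilies; a maximal one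
  turns out to be an upfamily.\<close>

lemma maximal_linked_extension:
  assumes "\<G> \<subseteq> Pow S" "linked \<G>" "S \<noteq> {}"
  obtains \<F> where "maximal_linked S \<F>" "\<G> \<subseteq> \<F>"
proof -
  define Z where "Z = {\<H>. \<H> \<subseteq> Pow S \<and> linked \<H> \<and> \<G> \<subseteq> \<H>}"
  have "\<exists>M\<in>Z. \<forall>H\<in>Z. M \<subseteq> H \<longrightarrow> H = M"
  proof (rule subset_Zorn_nonempty)
    show "Z \<noteq> {}" using assms by (auto simp: Z_def)
  next
    fix C assume C: "C \<noteq> {}" "subset.chain Z C"
    then have sub: "C \<subseteq> Z" and ch: "\<And>K H. K \<in> C \<Longrightarrow> H \<in> C \<Longrightarrow> K \<subseteq> H \<or> H \<subseteq> K"
      by (auto simp: subset_chain_def)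
    have "linked (\<Union>C)"
      unfolding linked_def
    proof (intro ballI)
      fix A B assume "A \<in> \<Union>C" "B \<in> \<Union>C"
      then obtain H where "H \<in> C" "A \<in> H" "B \<in> H" using ch by blast
      then show "A \<inter> B \<noteq> {}" using sub by (auto simp: Z_def linked_def)
    qed
    then show "\<Union>C \<in> Z" using C(1) sub by (auto simp: Z_def)
  qed
  then obtain M where "M \<in> Z" and maxZ: "\<And>H. H \<in> Z \<Longrightarrow> M \<subseteq> H \<Longrightarrow> H = M"
    by blast
  then have M: "M \<subseteq> Pow S" "linked M" "\<G> \<subseteq> M"
    by (auto simp: Z_def)
  have max: "H = M" if "H \<subseteq> Pow S" "linked H" "M \<subseteq> H" for H
    using maxZ that M(3) by (simp add: Z_def)
  \<comment> \<open>By maximality every nonempty set that meets all members belongs to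
    \<open>M\<close>; nonemptiness of \<open>M\<close> and closure under supersets both come from
    this.\<close>
  have mem: "E \<in> M" if "E \<subseteq> S" "E \<noteq> {}" "\<And>F. F \<in> M \<Longrightarrow> F \<inter> E \<noteq> {}" for E
  proof -
    have "linked (insert E M)" using M(2) that(2,3) unfolding linked_def by (auto; blast)
    then have "insert E M = M" using M(1) that(1) by (intro max) auto
    then show ?thesis by blast
  qed
  have "upfamily S M"
    unfolding upfamily_def
  proof (intro conjI allI impI ballI)
    have "F \<inter> S \<noteq> {}" if "F \<in> M" for F using M(1,2) that unfolding linked_def by fast
    then have "S \<in> M" using assms(3) by (intro mem) auto
    then show "M \<noteq> {}" by blast
  next
    fix F assume "F \<in> M"
    then show "F \<noteq> {}" "F \<subseteq> S" using M(1,2) unfolding linked_def by auto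
  next
    fix F E assume *: "F \<in> M \<and> F \<subseteq> E \<and> E \<subseteq> S"
    then have "F \<inter> F \<noteq> {}" and "\<And>D. D \<in> M \<Longrightarrow> D \<inter> F \<noteq> {}" using M(2) unfolding linked_def by auto
    then show "E \<in> M" using * by (intro mem) blast+
  qed
  then have "maximal_linked S M"
    unfolding maximal_linked_def using M(2) max upfamilyD(1) by (metis PowI subsetI)
  then show ?thesis using that M(3) by blast
qed

section \<open>Principal and two-out-of-three upfamilies\<close>

definition principal :: "'a set \<Rightarrow> 'a \<Rightarrow> 'a set set" where
  "principal S x = {E. E \<subseteq> S \<and> x \<in> E}"

lemma principal_in_superextension:
  assumes "x \<in> S"
  shows "principal S x \<in> superextension S"
  unfolding superextension_def
proof (rule CollectI, rule maximal_linkedI)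
  have "S \<in> principal S x" using assms by (simp add: principal_def)
  then show "upfamily S (principal S x)"
    unfolding upfamily_def principal_def by blast
  show "linked (principal S x)"
    unfolding linked_def principal_def by blast
  show "E \<in> principal S x \<or> S - E \<in> principal S x" if "E \<subseteq> S" for E
    using that assms unfolding principal_def by blast
qed

text \<open>A predicate on points rather than a cardinality, so that it can be nested: at least two
  rows with at least two marked cells each. Finite cases then reduce to propositional logic.\<close>

definition two_of :: "'a \<Rightarrow> 'a \<Rightarrow> 'a \<Rightarrow> ('a \<Rightarrow> bool) \<Rightarrow> bool" where
  "two_of a b c P \<longleftrightarrow> P a \<and> P b \<or> P a \<and> P c \<or> P b \<and> P c"

definition majority :: "'a set \<Rightarrow> 'a \<Rightarrow> 'a \<Rightarrow> 'a \<Rightarrow> 'a set set" where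
  "majority S a b c = {E. E \<subseteq> S \<and> two_of a b c (\<lambda>x. x \<in> E)}"

text \<open>Two pairs out of three points share a point, and of a set and its complement one
  contains two of the points.\<close>

lemma majority_in_superextension:
  assumes "a \<in> S" "b \<in> S" "c \<in> S" "distinct [a, b, c]"
  shows "majority S a b c \<in> superextension S"
  unfolding superextension_def
proof (rule CollectI, rule maximal_linkedI)
  have "S \<in> majority S a b c" using assms by (auto simp: majority_def two_of_def)
  then show "upfamily S (majority S a b c)"
    unfolding upfamily_def majority_def two_of_def by blast
  show "linked (majority S a b c)"
    unfolding linked_def majority_def two_of_def by blast
  show "E \<in> majority S a b c \<or> S - E \<in> majority S a b c" if "E \<subseteq> S" for E
    using that assms by (auto simp: majority_def two_of_def)
qed

section \<open>The two products\<close>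

lemma bex_Collect2: "(\<exists>G\<in>{f A B | A B. P A B}. Q G) \<longleftrightarrow> (\<exists>A B. P A B \<and> Q (f A B))"
  by blast

lemma mem_upfamily_mult:
  "E \<in> upfamily_mult X \<A> \<B> \<longleftrightarrow> E \<subseteq> carrier X \<and>
    (\<exists>A\<in>\<A>. \<exists>B. (\<forall>a\<in>A. B a \<in> \<B>) \<and> (\<forall>a\<in>A. \<forall>b\<in>B a. a \<otimes>\<^bsub>X\<^esub> b \<in> E))"
proof -
  have "(\<Union>a\<in>A. a <#\<^bsub>X\<^esub> B a) \<subseteq> E \<longleftrightarrow> (\<forall>a\<in>A. \<forall>b\<in>B a. a \<otimes>\<^bsub>X\<^esub> b \<in> E)" for A B
    by (simp add: l_coset_def UN_subset_iff)
  moreover have "E \<in> upfamily_mult X \<A> \<B> \<longleftrightarrow> E \<subseteq> carrier X \<and>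
      (\<exists>A\<in>\<A>. \<exists>B. (\<forall>a\<in>A. B a \<in> \<B>) \<and> (\<Union>a\<in>A. a <#\<^bsub>X\<^esub> B a) \<subseteq> E)"
    unfolding upfamily_mult_def generated_upfamily_def bex_Collect2 by (simp add: Bex_def)
  ultimately show ?thesis by simp
qed

lemma mem_upfamily_setmult:
  "E \<in> upfamily_setmult X \<A> \<B> \<longleftrightarrow> E \<subseteq> carrier X \<and>
    (\<exists>A\<in>\<A>. \<exists>B\<in>\<B>. \<forall>a\<in>A. \<forall>b\<in>B. a \<otimes>\<^bsub>X\<^esub> b \<in> E)"
proof -
  have "A <#>\<^bsub>X\<^esub> B \<subseteq> E \<longleftrightarrow> (\<forall>a\<in>A. \<forall>b\<in>B. a \<otimes>\<^bsub>X\<^esub> b \<in> E)" for A B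
    by (simp add: set_mult_def UN_subset_iff)
  moreover have "E \<in> upfamily_setmult X \<A> \<B> \<longleftrightarrow> E \<subseteq> carrier X \<and>
      (\<exists>A\<in>\<A>. \<exists>B\<in>\<B>. A <#>\<^bsub>X\<^esub> B \<subseteq> E)"
    unfolding upfamily_setmult_def generated_upfamily_def bex_Collect2 by (auto simp: Bex_def)
  ultimately show ?thesis by simp
qed

text \<open>Two members have a common row index \<open>a\<close>, the sets chosen for
  \<open>a\<close> have a common point \<open>b\<close>, and \<open>a \<otimes> b\<close> lies in
  both members.\<close>

lemma upfamily_mult_linked:
  assumes "linked \<A>" "linked \<B>"
  shows "linked (upfamily_mult X \<A> \<B>)"
  unfolding linked_def
proof (intro ballI)
  fix E F assume "E \<in> upfamily_mult X \<A> \<B>" "F \<in> upfamily_mult X \<A> \<B>"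
  then obtain A B A' B' where
    E: "A \<in> \<A>" "\<And>a. a \<in> A \<Longrightarrow> B a \<in> \<B>" "\<And>a b. a \<in> A \<Longrightarrow> b \<in> B a \<Longrightarrow> a \<otimes>\<^bsub>X\<^esub> b \<in> E" and
    F: "A' \<in> \<A>" "\<And>a. a \<in> A' \<Longrightarrow> B' a \<in> \<B>" "\<And>a b. a \<in> A' \<Longrightarrow> b \<in> B' a \<Longrightarrow> a \<otimes>\<^bsub>X\<^esub> b \<in> F"
    unfolding mem_upfamily_mult by metis
  obtain a where a: "a \<in> A" "a \<in> A'" using assms(1) E(1) F(1) unfolding linked_def by blast
  obtain b where "b \<in> B a" "b \<in> B' a"
    using assms(2) E(2)[OF a(1)] F(2)[OF a(2)] unfolding linked_def by blast
  then show "E \<inter> F \<noteq> {}" using E(3) F(3) a by blast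
qed

section \<open>Sufficiency\<close>

text \<open>Only one inclusion has to be checked: a constant choice of \<open>B\<close> puts every
  set product into \<open>upfamily_mult\<close>, and commutativity of the semigroup makes
  \<open>upfamily_setmult\<close> symmetric.\<close>

lemma supercommutativeI:
  assumes comm: "\<And>x y. x \<in> carrier X \<Longrightarrow> y \<in> carrier X \<Longrightarrow> x \<otimes>\<^bsub>X\<^esub> y = y \<otimes>\<^bsub>X\<^esub> x"
    and le: "\<And>\<A> \<B>. maximal_linked (carrier X) \<A> \<Longrightarrow> maximal_linked (carrier X) \<B> \<Longrightarrow>
      upfamily_mult X \<A> \<B> \<subseteq> upfamily_setmult X \<A> \<B>"
  shows "supercommutative_superextension X"
proof -
  have eq: "upfamily_mult X \<A> \<B> = upfamily_setmult X \<A> \<B>"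
    if "maximal_linked (carrier X) \<A>" "maximal_linked (carrier X) \<B>" for \<A> \<B>
  proof (rule antisym[OF le[OF that]], rule subsetI)
    fix E assume "E \<in> upfamily_setmult X \<A> \<B>"
    then obtain A B where *: "E \<subseteq> carrier X" "A \<in> \<A>" "B \<in> \<B>"
      "\<forall>a\<in>A. \<forall>b\<in>B. a \<otimes>\<^bsub>X\<^esub> b \<in> E"
      unfolding mem_upfamily_setmult by blast
    then show "E \<in> upfamily_mult X \<A> \<B>"
      unfolding mem_upfamily_mult by (intro conjI bexI[of _ A] exI[of _ "\<lambda>_. B"]) simp_all
  qed
  have swap: "upfamily_setmult X \<A> \<B> \<subseteq> upfamily_setmult X \<B> \<A>"
    if "maximal_linked (carrier X) \<A>" "maximal_linked (carrier X) \<B>" for \<A> \<B>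
  proof
    fix E assume "E \<in> upfamily_setmult X \<A> \<B>"
    then obtain A B where *: "E \<subseteq> carrier X" "A \<in> \<A>" "B \<in> \<B>"
      "\<forall>a\<in>A. \<forall>b\<in>B. a \<otimes>\<^bsub>X\<^esub> b \<in> E"
      unfolding mem_upfamily_setmult by blast
    moreover have "A \<subseteq> carrier X" "B \<subseteq> carrier X"
      using that *(2,3) upfamilyD(1) unfolding maximal_linked_def by blast+
    ultimately have "\<forall>b\<in>B. \<forall>a\<in>A. b \<otimes>\<^bsub>X\<^esub> a \<in> E" using comm by (metis subsetD)
    then show "E \<in> upfamily_setmult X \<B> \<A>"
      unfolding mem_upfamily_setmult using * by blast
  qed
  show ?thesis
    unfolding supercommutative_superextension_def superextension_def
    using eq swap by blast
qed

text \<open>A linked family containing \<open>{x}\<close> has \<open>x\<close> in all its members.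
  So \<open>{x}\<close> with the single set \<open>B x\<close> suffices in the first case,
  \<open>A\<close> with \<open>{x}\<close> in the second.\<close>

lemma upfamily_mult_le_setmult_singleton:
  assumes "linked \<A>" "linked \<B>" "{x} \<in> \<A> \<or> {x} \<in> \<B>"
  shows "upfamily_mult X \<A> \<B> \<subseteq> upfamily_setmult X \<A> \<B>"
proof
  fix E assume "E \<in> upfamily_mult X \<A> \<B>"
  then obtain A B where E: "E \<subseteq> carrier X" "A \<in> \<A>" "\<And>a. a \<in> A \<Longrightarrow> B a \<in> \<B>"
    "\<And>a b. a \<in> A \<Longrightarrow> b \<in> B a \<Longrightarrow> a \<otimes>\<^bsub>X\<^esub> b \<in> E"
    unfolding mem_upfamily_mult by metis
  from assms(3) show "E \<in> upfamily_setmult X \<A> \<B>"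
  proof
    assume x: "{x} \<in> \<A>"
    then have "x \<in> A" using assms(1) E(2) unfolding linked_def by blast
    then show ?thesis
      unfolding mem_upfamily_setmult using E x
      by (intro conjI bexI[of _ "{x}"] bexI[of _ "B x"]) auto
  next
    assume x: "{x} \<in> \<B>"
    then have "x \<in> B a" if "a \<in> A" for a using assms(2) E(3)[OF that] unfolding linked_def by blast
    then show ?thesis
      unfolding mem_upfamily_setmult using E x
      by (intro conjI bexI[of _ A] bexI[of _ "{x}"]) auto
  qed
qed

section \<open>Small carriers and finite chains\<close>

text \<open>On two points one of the complementary singletons belongs to every maximal linked
  upfamily.\<close>

lemma supercommutative_two_elements:
  assumes comm: "\<And>x y. x \<in> carrier X \<Longrightarrow> y \<in> carrier X \<Longrightarrow> x \<otimes>\<^bsub>X\<^esub> y = y \<otimes>\<^bsub>X\<^esub> x"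
    and X: "carrier X = {p, q}" and "p \<noteq> q"
  shows "supercommutative_superextension X"
proof (rule supercommutativeI[OF comm])
  fix \<A> \<B> assume ml: "maximal_linked (carrier X) \<A>" "maximal_linked (carrier X) \<B>"
  have "{p} \<in> \<A> \<or> {p, q} - {p} \<in> \<A>"
    using maximal_linked_compl[OF ml(1), of "{p}"] by (simp add: X)
  then have "{p} \<in> \<A> \<or> {q} \<in> \<A>"
    using \<open>p \<noteq> q\<close> by (auto simp: insert_Diff_if)
  then show "upfamily_mult X \<A> \<B> \<subseteq> upfamily_setmult X \<A> \<B>"
    using upfamily_mult_le_setmult_singleton ml unfolding maximal_linked_def by metis
qed

text \<open>The premise \<open>minor\<close> is a finite condition on the multiplication table. It
  settles the case in which neither family contains a singleton: then both contain all three pairs,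
  and their members are sets with at least two points.\<close>

lemma supercommutative_three_elements:
  assumes comm: "\<And>x y. x \<in> carrier X \<Longrightarrow> y \<in> carrier X \<Longrightarrow> x \<otimes>\<^bsub>X\<^esub> y = y \<otimes>\<^bsub>X\<^esub> x"
    and X: "carrier X = {p, q, r}" and pqr: "distinct [p, q, r]"
    and minor: "\<And>E. two_of p q r (\<lambda>a. two_of p q r (\<lambda>b. a \<otimes>\<^bsub>X\<^esub> b \<in> E)) \<Longrightarrow>
      \<exists>P\<in>{{p, q}, {p, r}, {q, r}}. \<exists>Q\<in>{{p, q}, {p, r}, {q, r}}. \<forall>a\<in>P. \<forall>b\<in>Q. a \<otimes>\<^bsub>X\<^esub> b \<in> E"
  shows "supercommutative_superextension X"
proof (rule supercommutativeI[OF comm])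
  fix \<A> \<B> assume ml: "maximal_linked (carrier X) \<A>" "maximal_linked (carrier X) \<B>"
  then have li: "linked \<A>" "linked \<B>" and up: "upfamily (carrier X) \<A>" "upfamily (carrier X) \<B>"
    unfolding maximal_linked_def by auto
  have diffs: "{p, q, r} - {p} = {q, r}" "{p, q, r} - {q} = {p, r}" "{p, q, r} - {r} = {p, q}"
    using pqr by auto
  show "upfamily_mult X \<A> \<B> \<subseteq> upfamily_setmult X \<A> \<B>"
  proof (cases "\<exists>x. {x} \<in> \<A> \<or> {x} \<in> \<B>")
    case True
    then show ?thesis using upfamily_mult_le_setmult_singleton[OF li] by blast
  next
    case False
    have pairs: "{p, q} \<in> \<F> \<and> {p, r} \<in> \<F> \<and> {q, r} \<in> \<F>"
      if "maximal_linked (carrier X) \<F>" "\<And>x. {x} \<notin> \<F>" for \<F>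
      using maximal_linked_compl[OF that(1), of "{p}"] maximal_linked_compl[OF that(1), of "{q}"]
        maximal_linked_compl[OF that(1), of "{r}"] that(2) by (simp add: X diffs)
    have two: "two_of p q r (\<lambda>x. x \<in> F)"
      if "F \<in> \<F>" "linked \<F>" "{p, q} \<in> \<F> \<and> {p, r} \<in> \<F> \<and> {q, r} \<in> \<F>" for F \<F>
    proof -
      have "F \<inter> {p, q} \<noteq> {}" "F \<inter> {p, r} \<noteq> {}" "F \<inter> {q, r} \<noteq> {}"
        using that unfolding linked_def by blast+
      then show ?thesis unfolding two_of_def by blast
    qed
    note pA = pairs[OF ml(1)] and pB = pairs[OF ml(2)]
    show ?thesis
    proof
      fix E assume "E \<in> upfamily_mult X \<A> \<B>"
      then obtain A B where E: "E \<subseteq> carrier X" "A \<in> \<A>" "\<And>a. a \<in> A \<Longrightarrow> B a \<in> \<B>"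
        "\<And>a b. a \<in> A \<Longrightarrow> b \<in> B a \<Longrightarrow> a \<otimes>\<^bsub>X\<^esub> b \<in> E"
        unfolding mem_upfamily_mult by metis
      have row: "two_of p q r (\<lambda>b. a \<otimes>\<^bsub>X\<^esub> b \<in> E)" if "a \<in> A" for a
        using two[OF E(3)[OF that] li(2)] pB False E(4)[OF that] unfolding two_of_def by blast
      have "two_of p q r (\<lambda>a. two_of p q r (\<lambda>b. a \<otimes>\<^bsub>X\<^esub> b \<in> E))"
        using two[OF E(2) li(1)] pA False row unfolding two_of_def[of p q r "\<lambda>x. x \<in> A"]
          two_of_def[of p q r "\<lambda>a. two_of p q r (\<lambda>b. a \<otimes>\<^bsub>X\<^esub> b \<in> E)"] by blast
      from minor[OF this] obtain P Q where "P \<in> \<A>" "Q \<in> \<B>" "\<forall>a\<in>P. \<forall>b\<in>Q. a \<otimes>\<^bsub>X\<^esub> b \<in> E"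
        using pA pB False by blast
      then show "E \<in> upfamily_setmult X \<A> \<B>"
        unfolding mem_upfamily_setmult using E(1) by blast
    qed
  qed
qed

text \<open>The rank \<open>r\<close> turns products into minima. The set product placed inside
  \<open>E\<close> is that of \<open>A\<close> with a single \<open>B c\<close>: each
  \<open>a \<otimes> b\<close> in it is either an \<open>a\<close> already known to lie in
  \<open>E\<close>, or equal to \<open>c \<otimes> b\<close>.\<close>

lemma supercommutative_finite_chain:
  fixes r :: "'a \<Rightarrow> nat"
  assumes inj: "inj_on r (carrier X)" and fin: "finite (carrier X)"
    and cl: "\<And>x y. x \<in> carrier X \<Longrightarrow> y \<in> carrier X \<Longrightarrow> x \<otimes>\<^bsub>X\<^esub> y \<in> carrier X"
    and min: "\<And>x y. x \<in> carrier X \<Longrightarrow> y \<in> carrier X \<Longrightarrow> r (x \<otimes>\<^bsub>X\<^esub> y) = min (r x) (r y)"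
  shows "supercommutative_superextension X"
proof (rule supercommutativeI)
  have mult: "x \<otimes>\<^bsub>X\<^esub> y = (if r x \<le> r y then x else y)"
    if "x \<in> carrier X" "y \<in> carrier X" for x y
  proof (cases "r x \<le> r y")
    case True
    then have "r (x \<otimes>\<^bsub>X\<^esub> y) = r x" using min[OF that] by simp
    then show ?thesis using inj_onD[OF inj _ cl[OF that] that(1)] True by simp
  next
    case False
    then have "r (x \<otimes>\<^bsub>X\<^esub> y) = r y" using min[OF that] by simp
    then show ?thesis using inj_onD[OF inj _ cl[OF that] that(2)] False by simp
  qed
  show "x \<otimes>\<^bsub>X\<^esub> y = y \<otimes>\<^bsub>X\<^esub> x" if "x \<in> carrier X" "y \<in> carrier X" for x y
    using inj_onD[OF inj _ that] by (simp add: mult that)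
  fix \<A> \<B> assume "maximal_linked (carrier X) \<A>" "maximal_linked (carrier X) \<B>"
  then have up: "upfamily (carrier X) \<A>" "upfamily (carrier X) \<B>"
    unfolding maximal_linked_def by auto
  show "upfamily_mult X \<A> \<B> \<subseteq> upfamily_setmult X \<A> \<B>"
  proof
    fix E assume "E \<in> upfamily_mult X \<A> \<B>"
    then obtain A B where E: "E \<subseteq> carrier X" "A \<in> \<A>" "\<And>a. a \<in> A \<Longrightarrow> B a \<in> \<B>"
      "\<And>a b. a \<in> A \<Longrightarrow> b \<in> B a \<Longrightarrow> a \<otimes>\<^bsub>X\<^esub> b \<in> E"
      unfolding mem_upfamily_mult by metis
    have A: "A \<subseteq> carrier X" "A \<noteq> {}" "finite A"
      using upfamilyD(1)[OF up(1) E(2)] upfamilyD(3)[OF up(1)] E(2) finite_subset[OF _ fin] by blast+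
    have multA: "a \<otimes>\<^bsub>X\<^esub> b = (if r a \<le> r b then a else b)" if "a \<in> A" "c \<in> A" "b \<in> B c" for a b c
      using mult[OF subsetD[OF A(1) that(1)] subsetD[OF upfamilyD(1)[OF up(2) E(3)[OF that(2)]] that(3)]] .
    \<comment> \<open>Every element of \<open>A\<close> below the first \<open>a\<close> with \<open>B a\<close> strictly below \<open>a\<close> lies in \<open>E\<close>.\<close>
    define bad where "bad = {a \<in> A. \<forall>b\<in>B a. r b < r a}"
    have good: "a \<in> E" if a: "a \<in> A" "a \<notin> bad" for a
    proof -
      obtain b where b: "b \<in> B a" "r a \<le> r b"
        using a unfolding bad_def by (auto simp: not_less)
      then show ?thesis using E(4)[OF a(1) b(1)] multA[OF a(1) a(1) b(1)] by simp
    qed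
    \<comment> \<open>If nothing is bad, \<open>A\<close> lies in \<open>E\<close> and the top of
      \<open>A\<close> serves as \<open>c\<close>. Otherwise \<open>c\<close> is the least bad
      element: everything in \<open>A\<close> below it lies in \<open>E\<close>, and
      \<open>B c\<close> lies strictly below it.\<close>
    obtain c where c: "c \<in> A"
      and split: "\<And>a b. a \<in> A \<Longrightarrow> b \<in> B c \<Longrightarrow> if r a \<le> r b then a \<in> E else r b < r c"
    proof (cases "bad = {}")
      case True
      have "Max (r ` A) \<in> r ` A" using A(2,3) by (intro Max_in) simp_all
      then obtain c where "c \<in> A" "r c = Max (r ` A)" by force
      then have c: "c \<in> A" "\<And>a. a \<in> A \<Longrightarrow> r a \<le> r c" using A(3) by simp_all
      show ?thesis
      proof (rule that[OF c(1)])
        fix a b assume "a \<in> A" "b \<in> B c"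
        then show "if r a \<le> r b then a \<in> E else r b < r c"
          using c(2)[of a] good[of a] True by auto
      qed
    next
      case False
      then obtain c where c: "c \<in> bad" "\<And>a. a \<in> bad \<Longrightarrow> r c \<le> r a"
        using ex_has_least_nat[of "\<lambda>a. a \<in> bad" _ r] by blast
      have lt: "a \<in> E" if "a \<in> A" "r a < r c" for a
        using good[OF that(1)] c(2) that(2) by (meson not_less)
      show ?thesis
      proof (rule that[of c])
        show "c \<in> A" using c(1) unfolding bad_def by blast
        fix a b assume "a \<in> A" "b \<in> B c"
        moreover from this have "r b < r c" using c(1) unfolding bad_def by blast
        ultimately show "if r a \<le> r b then a \<in> E else r b < r c" using lt by auto
      qed
    qed
    have "a \<otimes>\<^bsub>X\<^esub> b \<in> E" if "a \<in> A" "b \<in> B c" for a b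
    proof (cases "r a \<le> r b")
      case True
      then show ?thesis using split[OF that] multA[OF that(1) c that(2)] by simp
    next
      case False
      then have "c \<otimes>\<^bsub>X\<^esub> b = b" "a \<otimes>\<^bsub>X\<^esub> b = b"
        using split[OF that] multA[OF that(1) c that(2)] multA[OF c c that(2)] by auto
      then show ?thesis using E(4)[OF c that(2)] by simp
    qed
    then show "E \<in> upfamily_setmult X \<A> \<B>"
      unfolding mem_upfamily_setmult using E(1-3) c by blast
  qed
qed

section \<open>Necessity\<close>

lemma mem_upfamily_multI:
  assumes "E \<subseteq> carrier X" "A \<in> \<A>" "\<And>a. a \<in> A \<Longrightarrow> \<exists>B\<in>\<B>. \<forall>b\<in>B. a \<otimes>\<^bsub>X\<^esub> b \<in> E"
  shows "E \<in> upfamily_mult X \<A> \<B>"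
proof -
  have "\<forall>a\<in>A. \<exists>B. B \<in> \<B> \<and> (\<forall>b\<in>B. a \<otimes>\<^bsub>X\<^esub> b \<in> E)" using assms(3) by blast
  from bchoice[OF this] show ?thesis
    unfolding mem_upfamily_mult using assms(1,2) by blast
qed

lemma majority_pair:
  assumes "A \<in> majority S a b c"
  shows "\<exists>P\<in>{{a, b}, {a, c}, {b, c}}. P \<subseteq> A"
  using assms unfolding majority_def two_of_def by simp

locale supercommutative_regular = regular_carrier_semigroup X for X (structure) +
  assumes supercommutative: "supercommutative_superextension X"
begin

lemma mult_eq_setmult:
  assumes "\<A> \<in> superextension (carrier X)" "\<B> \<in> superextension (carrier X)"
  shows "upfamily_mult X \<A> \<B> = upfamily_setmult X \<A> \<B>"
  using bspec[OF bspec[OF supercommutative[unfolded supercommutative_superextension_def] assms(1)] assms(2)]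
  by (elim conjE)

lemma upfamily_mult_commute:
  assumes "\<A> \<in> superextension (carrier X)" "\<B> \<in> superextension (carrier X)"
  shows "upfamily_mult X \<A> \<B> = upfamily_mult X \<B> \<A>"
  using bspec[OF bspec[OF supercommutative[unfolded supercommutative_superextension_def] assms(1)] assms(2)]
  by (elim conjE) (rule trans[OF _ trans])

text \<open>The product of the principal upfamilies at \<open>x\<close> and \<open>y\<close>
  contains \<open>{x \<otimes> y}\<close>; so does the product in the other order, all of whose
  members contain \<open>y \<otimes> x\<close>.\<close>

lemma m_comm:
  assumes "x \<in> carrier X" "y \<in> carrier X"
  shows "x \<otimes> y = y \<otimes> x"
proof -
  let ?p = "principal (carrier X)"
  have "{x \<otimes> y} \<in> upfamily_mult X (?p x) (?p y)"
    using assms by (intro mem_upfamily_multI[of _ _ "{x}"]) (auto simp: principal_def m_closed)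
  then have "{x \<otimes> y} \<in> upfamily_mult X (?p y) (?p x)"
    using upfamily_mult_commute assms principal_in_superextension by metis
  then obtain A B where "y \<in> A" "\<forall>a\<in>A. x \<in> B a" "\<forall>a\<in>A. \<forall>b\<in>B a. a \<otimes> b = x \<otimes> y"
    unfolding mem_upfamily_mult principal_def by auto
  then show ?thesis by metis
qed

text \<open>The main tool of this direction: \<open>E\<close> marks cells of a 3 x 3 table, and two
  rows with two marked cells each force a fully marked 2 x 2 minor. Each use below exhibits a table
  and a set \<open>E\<close> without such a minor.\<close>

lemma minor:
  assumes "a1 \<in> carrier X" "a2 \<in> carrier X" "a3 \<in> carrier X" "distinct [a1, a2, a3]"
    and "b1 \<in> carrier X" "b2 \<in> carrier X" "b3 \<in> carrier X" "distinct [b1, b2, b3]"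
    and E: "E \<subseteq> carrier X"
    and rows: "two_of a1 a2 a3 (\<lambda>a. two_of b1 b2 b3 (\<lambda>b. a \<otimes> b \<in> E))"
  shows "\<exists>P\<in>{{a1, a2}, {a1, a3}, {a2, a3}}. \<exists>Q\<in>{{b1, b2}, {b1, b3}, {b2, b3}}.
    \<forall>a\<in>P. \<forall>b\<in>Q. a \<otimes> b \<in> E"
proof -
  let ?A = "majority (carrier X) a1 a2 a3" and ?B = "majority (carrier X) b1 b2 b3"
  \<comment> \<open>The rows with at least two marked cells; they form the member of the first
    family.\<close>
  define R where "R = {a \<in> {a1, a2, a3}. two_of b1 b2 b3 (\<lambda>b. a \<otimes> b \<in> E)}"
  have "E \<in> upfamily_mult X ?A ?B"
  proof (rule mem_upfamily_multI[OF E, of R])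
    have "R \<subseteq> carrier X" using assms(1-3) unfolding R_def by blast
    moreover have "two_of a1 a2 a3 (\<lambda>x. x \<in> R)"
      using rows unfolding R_def two_of_def[of a1] by simp
    ultimately show "R \<in> ?A" unfolding majority_def by simp
    fix a assume "a \<in> R"
    then have "two_of b1 b2 b3 (\<lambda>b. a \<otimes> b \<in> E)" unfolding R_def by simp
    then have "{b \<in> {b1, b2, b3}. a \<otimes> b \<in> E} \<in> ?B"
      using assms(5-7) unfolding majority_def two_of_def by auto
    then show "\<exists>B\<in>?B. \<forall>b\<in>B. a \<otimes> b \<in> E"
      by (rule rev_bexI) simp
  qed
  then have "E \<in> upfamily_setmult X ?A ?B"
    using mult_eq_setmult majority_in_superextension assms(1-8) by metis
  then obtain A B where AB: "A \<in> ?A" "B \<in> ?B" "\<forall>a\<in>A. \<forall>b\<in>B. a \<otimes> b \<in> E"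
    unfolding mem_upfamily_setmult by blast
  obtain P where P: "P \<in> {{a1, a2}, {a1, a3}, {a2, a3}}" "P \<subseteq> A"
    using majority_pair[OF AB(1)] by (rule bexE)
  obtain Q where Q: "Q \<in> {{b1, b2}, {b1, b3}, {b2, b3}}" "Q \<subseteq> B"
    using majority_pair[OF AB(2)] by (rule bexE)
  show ?thesis
    by (intro bexI[OF _ P(1)] bexI[OF _ Q(1)]) (use AB(3) P(2) Q(2) in blast)
qed

subsection \<open>Subgroups\<close>

text \<open>With \<open>x = x \<otimes> y \<otimes> x\<close>, the idempotent
  \<open>e = x \<otimes> y\<close> is neutral for \<open>x\<close> and its powers. If the cube
  differs from \<open>x\<close>, then in the table of \<open>e\<close>, \<open>x\<close>,
  \<open>x \<otimes> x\<close> the set \<open>{x, x \<otimes> x}\<close> marks two cells in the rows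
  of \<open>e\<close> and \<open>x\<close>, while every minor contains \<open>e\<close> or the
  cube.\<close>

lemma cube:
  assumes x: "x \<in> carrier X"
  shows "x \<otimes> (x \<otimes> x) = x"
proof (rule ccontr)
  assume ncube: "x \<otimes> (x \<otimes> x) \<noteq> x"
  obtain y where y: "y \<in> carrier X" and xyx: "x \<otimes> y \<otimes> x = x" using regular[OF x] by metis
  define e where "e = x \<otimes> y"
  have e: "e \<in> carrier X" using x y m_closed by (simp add: e_def)
  have xx: "x \<otimes> x \<in> carrier X" and xxx: "x \<otimes> (x \<otimes> x) \<in> carrier X" using x m_closed by simp_all
  have ex: "e \<otimes> x = x" using xyx by (simp add: e_def)
  then have xe: "x \<otimes> e = x" using m_comm x e by simp
  have ee: "e \<otimes> e = e" using m_assoc[OF e x y] ex by (simp add: e_def)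
  have exx: "e \<otimes> (x \<otimes> x) = x \<otimes> x" using m_assoc[OF e x x] ex by simp
  have xxe: "(x \<otimes> x) \<otimes> e = x \<otimes> x" using m_assoc[OF x x e] xe by simp
  \<comment> \<open>Multiplying by \<open>y\<close> undoes multiplication by \<open>x\<close>,
    because \<open>x \<otimes> y = e\<close> fixes \<open>a\<close> and \<open>b\<close>.\<close>
  have cancel: "a = b" if "a \<otimes> x = b \<otimes> x" "a \<otimes> e = a" "b \<otimes> e = b" "a \<in> carrier X" "b \<in> carrier X" for a b
    using that m_assoc[OF _ x y] by (metis e_def)
  have "x \<noteq> e" using ncube ee by auto
  have "x \<otimes> x \<noteq> e" using ncube xe by auto
  have "x \<otimes> x \<noteq> x" using ncube by auto
  have xxx': "(x \<otimes> x) \<otimes> x = x \<otimes> (x \<otimes> x)" using m_assoc x by simp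
  have "x \<otimes> (x \<otimes> x) \<noteq> x \<otimes> x" using cancel[of "x \<otimes> x" x] xxx' xxe xe x xx \<open>x \<otimes> x \<noteq> x\<close> by metis
  show False
    using minor[of e x "x \<otimes> x" e x "x \<otimes> x" "{x, x \<otimes> x}"] e x xx
      ee ex xe exx xxe xxx' ncube \<open>x \<noteq> e\<close> \<open>x \<otimes> x \<noteq> e\<close> \<open>x \<otimes> x \<noteq> x\<close> \<open>x \<otimes> (x \<otimes> x) \<noteq> x \<otimes> x\<close>
    by (simp add: two_of_def)
qed

lemma square_idem:
  assumes "x \<in> carrier X"
  shows "(x \<otimes> x) \<otimes> (x \<otimes> x) = x \<otimes> x"
  using m_assoc[OF assms assms m_closed[OF assms assms]] cube[OF assms] by simp

text \<open>In the table of \<open>e\<close>, \<open>x\<close>, \<open>y\<close> the diagonal is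
  constantly \<open>e\<close> and all other cells are marked. Two pairs out of three indices always
  share one, so every minor contains a diagonal cell.\<close>

lemma unique_involution:
  assumes e: "e \<in> carrier X" "e \<otimes> e = e"
    and x: "x \<in> carrier X" "x \<otimes> x = e" "x \<noteq> e"
    and y: "y \<in> carrier X" "y \<otimes> y = e" "y \<noteq> e"
  shows "x = y"
proof (rule ccontr)
  assume "x \<noteq> y"
  have xe: "x \<otimes> e = x" "e \<otimes> x = x" and ye: "y \<otimes> e = y" "e \<otimes> y = y"
    using cube[OF x(1)] cube[OF y(1)] x y e m_comm by auto
  have "x \<otimes> y \<noteq> e"
    using m_assoc[OF x(1) x(1) y(1)] x(2) xe ye \<open>x \<noteq> y\<close> by metis
  moreover have "y \<otimes> x = x \<otimes> y" using m_comm x y by simp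
  moreover have "x \<otimes> y \<in> carrier X" using m_closed x y by simp
  ultimately show False
    using minor[of e x y e x y "{x, y, x \<otimes> y}"] e x y xe ye \<open>x \<noteq> y\<close>
    by (auto simp: two_of_def)
qed

text \<open>In the table of \<open>f\<close>, \<open>e\<close>, \<open>g\<close> the set
  \<open>{f, g}\<close> marks columns \<open>f\<close>, \<open>g\<close> in row \<open>f\<close>,
  column \<open>g\<close> in row \<open>e\<close> and columns \<open>f\<close>, \<open>e\<close> in
  row \<open>g\<close>; no two rows share two marked columns.\<close>

lemma no_idem_above_involution:
  assumes e: "e \<in> carrier X" "e \<otimes> e = e"
    and g: "g \<in> carrier X" "g \<otimes> g = e" "g \<noteq> e"
    and f: "f \<in> carrier X" "f \<otimes> f = f" "f \<otimes> e = e"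
  shows "f = e"
proof (rule ccontr)
  assume "f \<noteq> e"
  have ge: "g \<otimes> e = g" "e \<otimes> g = g" using cube[OF g(1)] g e m_comm by auto
  have fg: "f \<otimes> g = g" using m_assoc[OF f(1) e(1) g(1)] f ge by simp
  have "e \<otimes> f = e" "g \<otimes> f = g" using f fg m_comm e g by metis+
  moreover have "f \<noteq> g" using \<open>f \<noteq> e\<close> f(2) g(2) by metis
  ultimately show False
    using minor[of f e g f e g "{f, g}"] e f g ge fg \<open>f \<noteq> e\<close> by (auto simp: two_of_def)
qed

text \<open>The product \<open>h = f \<otimes> e\<close> is an idempotent strictly below
  \<open>e\<close>. First \<open>g\<close> is shown to act on \<open>f\<close> in the same way as
  \<open>e\<close>, giving \<open>h\<close>; then a table excludes
  \<open>h \<noteq> f\<close>.\<close>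

lemma idem_below_involution:
  assumes e: "e \<in> carrier X" "e \<otimes> e = e"
    and g: "g \<in> carrier X" "g \<otimes> g = e" "g \<noteq> e"
    and f: "f \<in> carrier X" "f \<otimes> f = f" "f \<noteq> e"
  shows "f \<otimes> e = f" "f \<otimes> g = f"
proof -
  define h where "h = f \<otimes> e"
  have h: "h \<in> carrier X" using f e m_closed by (simp add: h_def)
  have ge: "g \<otimes> e = g" "e \<otimes> g = g" using cube[OF g(1)] g e m_comm by auto
  have he: "h \<otimes> e = h" using m_assoc[OF f(1) e(1) e(1)] e(2) by (simp add: h_def)
  have eh: "e \<otimes> h = h" using he m_comm h e by metis
  have fh: "f \<otimes> h = h" using m_assoc[OF f(1) f(1) e(1)] f(2) by (simp add: h_def)
  have hh: "h \<otimes> h = h" using m_assoc[OF f(1) e(1) h] fh eh by (simp add: h_def)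
  have "h \<noteq> e" using no_idem_above_involution[OF e g f(1,2)] f(3) by (auto simp: h_def)
  have hg: "h \<otimes> g \<in> carrier X" using h g m_closed by simp
  have "h \<otimes> g \<otimes> (h \<otimes> g) = h \<otimes> (g \<otimes> (h \<otimes> g))" using m_assoc h g hg by simp
  also have "g \<otimes> (h \<otimes> g) = h" using m_comm[OF g(1) hg] m_assoc[OF h g(1) g(1)] g(2) he by simp
  finally have hghg: "h \<otimes> g \<otimes> (h \<otimes> g) = h" using hh by simp
  \<comment> \<open>Otherwise \<open>h \<otimes> g\<close> would be a nontrivial square root of the
    idempotent \<open>h\<close>, with the idempotent \<open>e\<close> above
    \<open>h\<close>.\<close>
  have hg: "h \<otimes> g = h"
    using no_idem_above_involution[OF h hh hg hghg _ e(1) e(2) eh] \<open>h \<noteq> e\<close> by metis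
  have fg: "f \<otimes> g = h" using m_assoc[OF f(1) e(1) g(1)] ge(2) hg by (simp add: h_def)
  have "h = f"
  proof (rule ccontr)
    assume "h \<noteq> f"
    have "g \<noteq> h" "f \<noteq> g" using hh g(2) \<open>h \<noteq> e\<close> f by metis+
    moreover have "e \<otimes> f = h" "g \<otimes> f = h" using m_comm f e g fg h_def by metis+
    ultimately show False
      \<comment> \<open>The rows are \<open>f, h, h\<close>, then \<open>h, e, g\<close>, then
        \<open>h, g, e\<close>: each has exactly two marked cells, and any two rows share only one
        marked column.\<close>
      using minor[of f e g f e g "{h, e}"] e f g h ge fg h_def[symmetric] \<open>h \<noteq> e\<close> \<open>h \<noteq> f\<close>
      by (auto simp: two_of_def)
  qed
  then show "f \<otimes> e = f" "f \<otimes> g = f" using h_def fg by simp_all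
qed

text \<open>Two comparable idempotents other than \<open>e\<close> coincide by a table
  (\<open>eq\<close>). For arbitrary \<open>f\<close> and \<open>k\<close> this is applied to their
  product, which lies below both.\<close>

lemma unique_idem_below_involution:
  assumes e: "e \<in> carrier X" "e \<otimes> e = e"
    and g: "g \<in> carrier X" "g \<otimes> g = e" "g \<noteq> e"
    and f: "f \<in> carrier X" "f \<otimes> f = f" "f \<noteq> e"
    and k: "k \<in> carrier X" "k \<otimes> k = k" "k \<noteq> e"
  shows "k = f"
proof -
  have ge: "g \<otimes> e = g" "e \<otimes> g = g" using cube[OF g(1)] g e m_comm by auto
  have eq: "c = a" if c: "c \<in> carrier X" "c \<otimes> c = c" "c \<noteq> e"
      and a: "a \<in> carrier X" "a \<otimes> a = a" "a \<noteq> e" and ca: "c \<otimes> a = c" for a c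
  proof (rule ccontr)
    assume "c \<noteq> a"
    have "c \<noteq> g" "a \<noteq> g" using c a g(2,3) by metis+
    moreover have "c \<otimes> e = c" "c \<otimes> g = c" "a \<otimes> e = a" "a \<otimes> g = a"
      using idem_below_involution[OF e g] c a by simp_all
    moreover from this have "e \<otimes> a = a" "g \<otimes> a = a" using m_comm a e g by metis+
    ultimately show False
      \<comment> \<open>Row \<open>c\<close> is constantly \<open>c\<close> and unmarked; the rows
        \<open>a, e, g\<close> and \<open>a, g, e\<close> share only the marked column
        \<open>a\<close>.\<close>
      using minor[of c e g a e g "{a, e}"] e g c a ca ge \<open>c \<noteq> a\<close> by (auto simp: two_of_def)
  qed
  define c where "c = k \<otimes> f"
  have c: "c \<in> carrier X" using k f m_closed by (simp add: c_def)
  have cf: "c \<otimes> f = c" using m_assoc[OF k(1) f(1) f(1)] f(2) by (simp add: c_def)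
  have kc: "k \<otimes> c = c" using m_assoc[OF k(1) k(1) f(1)] k(2) by (simp add: c_def)
  have ck: "c \<otimes> k = c" using kc m_comm c k by metis
  have "c \<otimes> c = c" using m_assoc[OF c k(1) f(1)] ck cf by (simp add: c_def)
  moreover have "c \<noteq> e"
    using idem_below_involution(1)[OF e g f] cf m_comm e f by metis
  ultimately show ?thesis using eq[OF c _ _ f cf] eq[OF c _ _ k ck] by metis
qed

text \<open>Elements are sorted by their squares, which are idempotent. The square \<open>e\<close>
  leaves only \<open>e\<close> and \<open>g\<close>; there is at most one other idempotent
  \<open>f\<close>.\<close>

lemma carrier_with_involution:
  assumes g: "g \<in> carrier X" "g \<otimes> g \<noteq> g"
  obtains "carrier X = {g \<otimes> g, g}"
  | f where "carrier X = {f, g \<otimes> g, g}" "f \<noteq> g \<otimes> g" "f \<noteq> g" "f \<otimes> f = f"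
    "f \<otimes> (g \<otimes> g) = f" "f \<otimes> g = f"
proof -
  define e where "e = g \<otimes> g"
  have e: "e \<in> carrier X" "e \<otimes> e = e" using g m_closed square_idem by (simp_all add: e_def)
  have ge: "g \<otimes> g = e" "g \<noteq> e" using g by (auto simp: e_def)
  have in_e: "x = e \<or> x = g" if "x \<in> carrier X" "x \<otimes> x = e" for x
    using unique_involution[OF e that _ g(1) ge] by blast
  show thesis
  proof (cases "\<exists>f\<in>carrier X. f \<otimes> f = f \<and> f \<noteq> e")
    case False
    have "x = e \<or> x = g" if "x \<in> carrier X" for x
      using False in_e[OF that] square_idem[OF that] m_closed[OF that that] by blast
    then have "carrier X = {e, g}" using e(1) g(1) by blast
    then show thesis using that(1) e_def by simp
  next
    case True
    then obtain f where f: "f \<in> carrier X" "f \<otimes> f = f" "f \<noteq> e" by blast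
    have fe: "f \<otimes> e = f" and fg: "f \<otimes> g = f" using idem_below_involution[OF e g(1) ge f] by simp_all
    have "x = f \<or> x = e \<or> x = g" if x: "x \<in> carrier X" for x
    proof (cases "x \<otimes> x = e")
      case True
      then show ?thesis using in_e x by blast
    next
      case False
      then have "x \<otimes> x = f"
        using unique_idem_below_involution[OF e g(1) ge f] square_idem[OF x] m_closed[OF x x] by blast
      \<comment> \<open>A further square root \<open>x\<close> of \<open>f\<close> is impossible,
        since the idempotent \<open>e\<close> lies above \<open>f\<close>.\<close>
      then have "x = f"
        using no_idem_above_involution[OF f(1,2) x _ _ e] fe m_comm e f by metis
      then show ?thesis by blast
    qed
    then have "carrier X = {f, e, g}" using e(1) g(1) f(1) by blast
    moreover have "f \<noteq> g" using f ge by metis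
    ultimately show thesis using that(2)[of f] f fe fg e_def by simp
  qed
qed

end

subsection \<open>Semilattices\<close>

locale supercommutative_semilattice = supercommutative_regular +
  assumes idem: "x \<in> carrier X \<Longrightarrow> x \<otimes> x = x"
begin

definition below :: "'a \<Rightarrow> 'a \<Rightarrow> bool" where
  "below x y \<longleftrightarrow> x \<otimes> y = x"

lemma below_refl: "x \<in> carrier X \<Longrightarrow> below x x"
  by (simp add: below_def idem)

lemma below_antisym:
  assumes "x \<in> carrier X" "y \<in> carrier X" "below x y" "below y x"
  shows "x = y"
  using assms m_comm unfolding below_def by metis

lemma below_trans:
  assumes "x \<in> carrier X" "y \<in> carrier X" "z \<in> carrier X" "below x y" "below y z"
  shows "below x z"
  using assms m_assoc unfolding below_def by metis

lemma meet_below: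
  assumes "x \<in> carrier X" "y \<in> carrier X"
  shows "below (x \<otimes> y) x" "below (x \<otimes> y) y"
proof -
  show "below (x \<otimes> y) y" using assms m_assoc idem unfolding below_def by simp
  have "below (y \<otimes> x) x" using assms m_assoc idem unfolding below_def by simp
  then show "below (x \<otimes> y) x" using m_comm assms by simp
qed

section \<open>Two incomparable elements of a semilattice\<close>

text \<open>With rows \<open>a\<close>, \<open>b\<close>, \<open>c = a \<otimes> b\<close> and
  columns \<open>a\<close>, \<open>b\<close>, \<open>d\<close>, only the cells equal to
  \<open>c\<close> are unmarked, so any two rows share only the marked column
  \<open>d\<close>.\<close>

lemma no_lower_bound_below_meet:
  assumes a: "a \<in> carrier X" and b: "b \<in> carrier X" and ab: "\<not> below a b" "\<not> below b a"
    and d: "d \<in> carrier X" "below d (a \<otimes> b)"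
  shows "d = a \<otimes> b"
proof (rule ccontr)
  assume "d \<noteq> a \<otimes> b"
  define c where "c = a \<otimes> b"
  have c: "c \<in> carrier X" using a b m_closed by (simp add: c_def)
  have ca: "below c a" "below c b" using meet_below a b by (simp_all add: c_def)
  have da: "below d a" "below d b" using below_trans[OF d(1) c] a b ca d(2) by (simp_all add: c_def)
  have t: "a \<otimes> a = a" "a \<otimes> b = c" "a \<otimes> d = d" "b \<otimes> a = c" "b \<otimes> b = b" "b \<otimes> d = d"
    "c \<otimes> a = c" "c \<otimes> b = c" "c \<otimes> d = d"
    using idem m_comm a b c d ca da c_def unfolding below_def by metis+
  have "a \<noteq> b" "c \<noteq> a" "c \<noteq> b" using ab below_refl a ca by auto
  moreover have "a \<noteq> d" "b \<noteq> d" using ab da by auto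
  moreover have "d \<noteq> c" using \<open>d \<noteq> a \<otimes> b\<close> by (simp add: c_def)
  ultimately show False
    using minor[of a b c a b d "{a, b, d}"] a b c d(1) t
    by (auto simp: two_of_def)
qed

text \<open>With rows \<open>a\<close>, \<open>b\<close>, \<open>c = a \<otimes> b\<close> and
  columns \<open>a\<close>, \<open>b\<close>, \<open>d\<close>, the rows are \<open>a, c, a\<close>,
  then \<open>c, b, b\<close>, then constantly \<open>c\<close>. Marking \<open>a\<close> and
  \<open>b\<close> leaves \<open>d\<close> as the only common column.\<close>

lemma no_upper_bound:
  assumes a: "a \<in> carrier X" and b: "b \<in> carrier X" and ab: "\<not> below a b" "\<not> below b a"
    and d: "d \<in> carrier X"
  shows "\<not> (below a d \<and> below b d)"
proof
  assume ad: "below a d \<and> below b d"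
  define c where "c = a \<otimes> b"
  have c: "c \<in> carrier X" using a b m_closed by (simp add: c_def)
  have ca: "below c a" "below c b" using meet_below a b by (simp_all add: c_def)
  have cd: "below c d" using below_trans[OF c a d] ca ad by simp
  have t: "a \<otimes> a = a" "a \<otimes> b = c" "a \<otimes> d = a" "b \<otimes> a = c" "b \<otimes> b = b" "b \<otimes> d = b"
    "c \<otimes> a = c" "c \<otimes> b = c" "c \<otimes> d = c"
    using idem m_comm a b c d ca ad cd c_def unfolding below_def by metis+
  have "a \<noteq> b" "c \<noteq> a" "c \<noteq> b" using ab below_refl a ca by auto
  moreover have "a \<noteq> d" "b \<noteq> d" using ab ad by auto
  ultimately show False
    using minor[of a b c a b d "{a, b}"] a b c d(1) t by (auto simp: two_of_def)
qed

text \<open>First \<open>d \<otimes> b\<close> must be \<open>c = a \<otimes> b\<close>: otherwise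
  it is incomparable with \<open>a\<close>, and \<open>d\<close> bounds both from above. Then
  \<open>{c, d}\<close> marks columns \<open>a\<close>, \<open>d\<close> in row \<open>b\<close>,
  columns \<open>b\<close>, \<open>d\<close> in row \<open>d\<close>, and a single cell in row
  \<open>a\<close>.\<close>

lemma no_strict_upper_bound:
  assumes a: "a \<in> carrier X" and b: "b \<in> carrier X" and ab: "\<not> below a b" "\<not> below b a"
    and d: "d \<in> carrier X" "below a d"
  shows "d = a"
proof (rule ccontr)
  assume "d \<noteq> a"
  define c where "c = a \<otimes> b"
  have c: "c \<in> carrier X" using a b m_closed by (simp add: c_def)
  have ca: "below c a" "below c b" using meet_below a b by (simp_all add: c_def)
  have e: "d \<otimes> b \<in> carrier X" using d b m_closed by simp
  have ae: "a \<otimes> (d \<otimes> b) = c" using m_assoc[OF a d(1) b] d(2) by (simp add: below_def c_def)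
  have db: "d \<otimes> b = c"
  proof (rule ccontr)
    assume ne: "d \<otimes> b \<noteq> c"
    have "\<not> below a (d \<otimes> b)" using ae ca ab unfolding below_def by metis
    moreover have "\<not> below (d \<otimes> b) a" using ae ne m_comm[OF a e] unfolding below_def by simp
    ultimately show False
      using no_upper_bound[OF a e _ _ d(1)] d(2) meet_below(1)[OF d(1) b] by blast
  qed
  have t: "a \<otimes> a = a" "a \<otimes> b = c" "a \<otimes> d = a" "b \<otimes> a = c" "b \<otimes> b = b" "b \<otimes> d = c"
    "d \<otimes> a = a" "d \<otimes> b = c" "d \<otimes> d = d"
    using idem m_comm a b c d ca db c_def unfolding below_def by metis+
  have "a \<noteq> b" "c \<noteq> a" "c \<noteq> b" using ab below_refl a ca by auto
  moreover have "b \<noteq> d" using ab d by auto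
  moreover have "c \<noteq> d" using below_antisym[OF a c] ca d(2) \<open>c \<noteq> a\<close> by blast
  ultimately show False
    using minor[of a b d a b d "{c, d}"] a b c d(1) t \<open>d \<noteq> a\<close> by (auto simp: two_of_def)
qed

lemma no_strict_lower_bound:
  assumes a: "a \<in> carrier X" and b: "b \<in> carrier X" and ab: "\<not> below a b" "\<not> below b a"
    and d: "d \<in> carrier X" "below d a"
  shows "d = a \<or> d = a \<otimes> b"
proof (cases "below d b")
  case True
  then have "below d (a \<otimes> b)" using m_assoc[OF d(1) a b] d(2) by (simp add: below_def)
  then show ?thesis using no_lower_bound_below_meet[OF a b ab d(1)] by simp
next
  case False
  have "\<not> below b d" using below_trans[OF b d(1) a] d(2) ab by blast
  \<comment> \<open>Here \<open>d\<close> and \<open>b\<close> are incomparable, so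
    \<open>a\<close>, lying above \<open>d\<close>, must be \<open>d\<close> itself.\<close>
  then show ?thesis using no_strict_upper_bound[OF d(1) b False _ a d(2)] by simp
qed

text \<open>A fourth element \<open>d\<close> would be incomparable with \<open>a\<close> and
  \<open>b\<close>, and all three pairwise meets would be \<open>a \<otimes> b\<close>. Marking just
  this value marks every cell off the diagonal, and each minor meets the diagonal.\<close>

lemma carrier_of_incomparable:
  assumes a: "a \<in> carrier X" and b: "b \<in> carrier X" and ab: "\<not> below a b" "\<not> below b a"
  shows "carrier X = {a \<otimes> b, a, b}"
proof -
  have ba: "b \<otimes> a = a \<otimes> b" using m_comm a b by simp
  have c: "a \<otimes> b \<in> carrier X" using a b m_closed by simp
  have "d \<in> {a \<otimes> b, a, b}" if d: "d \<in> carrier X" for d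
  proof (rule ccontr)
    assume nd: "d \<notin> {a \<otimes> b, a, b}"
    have da: "\<not> below d a" "\<not> below a d" "\<not> below d b" "\<not> below b d"
      using no_strict_lower_bound[OF a b ab d] no_strict_upper_bound[OF a b ab d]
        no_strict_lower_bound[OF b a ab(2,1) d] no_strict_upper_bound[OF b a ab(2,1) d] nd ba by auto
    \<comment> \<open>The product lies strictly below \<open>x\<close>, where only
      \<open>a \<otimes> b\<close> is left.\<close>
    have meet: "x \<otimes> y = a \<otimes> b"
      if "x \<in> {a, b}" "y \<in> carrier X" "\<not> below x y" "\<not> below y x" for x y
    proof -
      have x: "x \<in> carrier X" using that a b by auto
      have "x \<otimes> y = a \<or> x \<otimes> y = b \<or> x \<otimes> y = a \<otimes> b"
        using no_strict_lower_bound[OF a b ab m_closed[OF x that(2)]]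
          no_strict_lower_bound[OF b a ab(2,1) m_closed[OF x that(2)]]
          meet_below(1)[OF x that(2)] that(1) ba by auto
      then show ?thesis
        using that meet_below[OF x that(2)] ab unfolding below_def by auto
    qed
    have t: "a \<otimes> a = a" "b \<otimes> b = b" "d \<otimes> d = d" "a \<otimes> d = a \<otimes> b" "b \<otimes> d = a \<otimes> b"
      "d \<otimes> a = a \<otimes> b" "d \<otimes> b = a \<otimes> b"
      using idem a b d meet[of a d] meet[of b d] da m_comm by auto
    have "a \<noteq> b" "a \<otimes> b \<noteq> a" using ab below_refl[OF a] below_def by auto
    moreover have "a \<otimes> b \<noteq> b" using ab ba below_def by auto
    ultimately show False
      using minor[of a b d a b d "{a \<otimes> b}"] a b c d t ba nd by (auto simp: two_of_def)
  qed
  then show ?thesis using a b c by blast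
qed

section \<open>Chains without infinite monotone sequences\<close>

text \<open>
  A maximal linked upfamily containing the even tails of the sequence and one containing the odd
  tails have a product which, by commutativity, contains both the even and the odd terms.
\<close>

lemma no_monotone_sequence:
  fixes s :: "nat \<Rightarrow> 'a"
  assumes s: "range s \<subseteq> carrier X" "inj s"
    and mono: "(\<forall>i j. i < j \<longrightarrow> s i \<otimes> s j = s i) \<or> (\<forall>i j. i < j \<longrightarrow> s i \<otimes> s j = s j)"
  shows False
proof -
  define tail where "tail p n = s ` {i. n \<le> i \<and> i mod 2 = p}" for p n :: nat
  have tail: "tail p n \<subseteq> carrier X" for p n using s(1) by (auto simp: tail_def)
  have "\<exists>\<F>. maximal_linked (carrier X) \<F> \<and> range (tail p) \<subseteq> \<F>" if "p < 2" for p
  proof -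
    \<comment> \<open>An index of parity \<open>p\<close> that is at least \<open>n\<close> and at
      least \<open>m\<close>.\<close>
    have "s (2 * (n + m) + p) \<in> tail p n \<inter> tail p m" for n m
      using that unfolding tail_def by (intro IntI imageI) (auto simp: less_2_cases_iff)
    then have li: "linked (range (tail p))" unfolding linked_def by fast
    have "range (tail p) \<subseteq> Pow (carrier X)" using tail by auto
    from maximal_linked_extension[OF this li nonempty] show ?thesis by metis
  qed
  then obtain \<F> where ml: "\<And>p. p < 2 \<Longrightarrow> maximal_linked (carrier X) (\<F> p)"
    and in_F: "\<And>p n. p < 2 \<Longrightarrow> tail p n \<in> \<F> p"
    by (metis range_subsetD)
  have sup: "\<F> p \<in> superextension (carrier X)" if "p < 2" for p
    using ml[OF that] by (simp add: superextension_def)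
  have swap: "upfamily_mult X (\<F> 1) (\<F> 0) = upfamily_mult X (\<F> 0) (\<F> 1)"
    by (rule upfamily_mult_commute) (rule sup, simp)+
  have "tail 0 0 \<in> upfamily_mult X (\<F> 0) (\<F> 1) \<and> tail 1 0 \<in> upfamily_mult X (\<F> 0) (\<F> 1)"
    using mono
  proof
    assume inc: "\<forall>i j. i < j \<longrightarrow> s i \<otimes> s j = s i"
    \<comment> \<open>In row \<open>s i\<close> the tail beyond \<open>i\<close> gives only the
      product \<open>s i\<close>, so the terms of the left parity remain.\<close>
    have "tail p 0 \<in> upfamily_mult X (\<F> p) (\<F> q)" if "p < 2" "q < 2" for p q
    proof (rule mem_upfamily_multI[OF tail in_F[OF that(1)]])
      fix a assume "a \<in> tail p 0"
      then obtain i where "i mod 2 = p" "a = s i" by (auto simp: tail_def)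
      then show "\<exists>B\<in>\<F> q. \<forall>b\<in>B. a \<otimes> b \<in> tail p 0"
        using inc by (intro bexI[OF _ in_F[OF that(2), of "Suc i"]]) (auto simp: tail_def)
    qed
    from this[of 0 1] this[of 1 0] show ?thesis unfolding swap by simp
  next
    assume dec: "\<forall>i j. i < j \<longrightarrow> s i \<otimes> s j = s j"
    \<comment> \<open>Now the later factor wins, so the terms of the right parity remain.\<close>
    have "tail q 0 \<in> upfamily_mult X (\<F> p) (\<F> q)" if "p < 2" "q < 2" for p q
    proof (rule mem_upfamily_multI[OF tail in_F[OF that(1)]])
      fix a assume "a \<in> tail p 0"
      then obtain i where "a = s i" by (auto simp: tail_def)
      then show "\<exists>B\<in>\<F> q. \<forall>b\<in>B. a \<otimes> b \<in> tail q 0"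
        using dec by (intro bexI[OF _ in_F[OF that(2), of "Suc i"]]) (auto simp: tail_def)
    qed
    from this[of 0 1] this[of 1 0] show ?thesis unfolding swap by simp
  qed
  moreover have "linked (upfamily_mult X (\<F> 0) (\<F> 1))"
    using ml[of 0] ml[of 1] by (intro upfamily_mult_linked) (simp_all add: maximal_linked_def)
  ultimately have "tail 0 0 \<inter> tail 1 0 \<noteq> {}" unfolding linked_def by blast
  then show False by (auto simp: tail_def inj_eq[OF s(2)])
qed

text \<open>Pairs of indices of an injective sequence are coloured by whether the sequence increases
  along them; an infinite homogeneous set yields a monotone subsequence.\<close>

lemma finite_of_chain:
  assumes chain: "\<And>x y. x \<in> carrier X \<Longrightarrow> y \<in> carrier X \<Longrightarrow> below x y \<or> below y x"
  shows "finite (carrier X)"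
proof (rule ccontr)
  assume "infinite (carrier X)"
  then obtain s :: "nat \<Rightarrow> 'a" where s: "inj s" "range s \<subseteq> carrier X"
    using infinite_countable_subset by blast
  define f where "f P = (if below (s (Min P)) (s (Max P)) then 0 else 1::nat)" for P
  have "\<exists>Y t. Y \<subseteq> (UNIV :: nat set) \<and> infinite Y \<and> t < 2 \<and> (\<forall>x\<in>Y. \<forall>y\<in>Y. x \<noteq> y \<longrightarrow> f {x, y} = t)"
    by (rule Ramsey2) (auto simp: f_def)
  then obtain Y :: "nat set" and t where Y: "infinite Y" "\<forall>x\<in>Y. \<forall>y\<in>Y. x \<noteq> y \<longrightarrow> f {x, y} = t"
    by (elim exE conjE)
  define u where "u = s \<circ> enumerate Y"
  have u: "range u \<subseteq> carrier X" "inj u"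
    using s strict_mono_imp_inj_on[OF strict_mono_enumerate[OF Y(1)]]
    by (auto simp: u_def intro: inj_compose)
  have "f {enumerate Y i, enumerate Y j} = (if below (u i) (u j) then 0 else 1)" if "i < j" for i j
    using enumerate_mono[OF that Y(1)] by (simp add: f_def u_def min_def max_def)
  then have t: "(if below (u i) (u j) then 0 else 1) = t" if "i < j" for i j
    using Y(2)[rule_format, OF enumerate_in_set[OF Y(1), of i] enumerate_in_set[OF Y(1), of j]]
      enumerate_mono[OF that Y(1)] that by simp
  have "(\<forall>i j. i < j \<longrightarrow> u i \<otimes> u j = u i) \<or> (\<forall>i j. i < j \<longrightarrow> u i \<otimes> u j = u j)"
  proof (cases "t = 0")
    case True
    then show ?thesis using t unfolding below_def by (metis zero_neq_one)
  next
    case False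
    have "u i \<otimes> u j = u j" if "i < j" for i j
      using False t[OF that] chain[of "u i" "u j"] u(1) m_comm unfolding below_def
      by (metis rangeI subsetD)
    then show ?thesis by blast
  qed
  then show False using no_monotone_sequence[OF u] by blast
qed

section \<open>Isomorphism types of the semilattices\<close>

text \<open>The isomorphism counts the elements strictly below a given one. It is injective because
  the sets \<open>down x\<close> grow strictly along the chain, and surjective by counting.\<close>

lemma iso_linear_L:
  assumes chain: "\<And>x y. x \<in> carrier X \<Longrightarrow> y \<in> carrier X \<Longrightarrow> below x y \<or> below y x"
  shows "X \<cong> linear_L (card (carrier X))"
proof -
  note fin = finite_of_chain[OF chain]
  define down where "down x = {y \<in> carrier X. below y x \<and> y \<noteq> x}" for x
  define r where "r x = card (down x)" for x
  have fd: "finite (down x)" for x using fin by (simp add: down_def)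
  have sub: "down x \<subseteq> down y" if xy: "x \<in> carrier X" "y \<in> carrier X" "below x y" for x y
  proof
    fix z assume "z \<in> down x"
    then have z: "z \<in> carrier X" "below z x" "z \<noteq> x" by (simp_all add: down_def)
    then have "z \<noteq> y" using below_antisym xy by blast
    then show "z \<in> down y" using below_trans[OF z(1) xy(1,2) z(2) xy(3)] z(1) by (simp add: down_def)
  qed
  have le: "r x \<le> r y" if "x \<in> carrier X" "y \<in> carrier X" "below x y" for x y
    using card_mono[OF fd sub[OF that]] by (simp add: r_def)
  have neq: "r x \<noteq> r y" if "x \<in> carrier X" "y \<in> carrier X" "below x y" "x \<noteq> y" for x y
  proof -
    have "x \<in> down y" "x \<notin> down x" using that by (simp_all add: down_def)
    then have "down x \<subset> down y" using sub[OF that(1-3)] by blast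
    then show ?thesis using psubset_card_mono[OF fd] by (simp add: r_def less_imp_neq)
  qed
  have inj: "inj_on r (carrier X)"
    using chain neq unfolding inj_on_def by metis
  have "r x < card (carrier X)" if "x \<in> carrier X" for x
    unfolding r_def using that fin by (intro psubset_card_mono) (auto simp: down_def)
  then have "r ` carrier X \<subseteq> {0..<card (carrier X)}" by auto
  then have img: "r ` carrier X = {0..<card (carrier X)}"
    using card_image[OF inj] by (intro card_subset_eq) simp_all
  have "r (x \<otimes> y) = min (r x) (r y)" if xy: "x \<in> carrier X" "y \<in> carrier X" for x y
    using chain[OF xy]
  proof
    assume "below x y"
    then show ?thesis using le[OF xy] by (simp add: below_def)
  next
    assume "below y x"
    then show ?thesis using le[OF xy(2,1)] m_comm[OF xy] by (simp add: below_def)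
  qed
  moreover have "r x \<in> {0..<card (carrier X)}" if "x \<in> carrier X" for x
    using img that by blast
  ultimately have "r \<in> iso X (linear_L (card (carrier X)))"
    using inj img by (auto simp: iso_def hom_def bij_betw_def linear_L_def semigroup_of_def)
  then show ?thesis by (rule is_isoI)
qed

lemma iso_V3:
  assumes a: "a \<in> carrier X" and b: "b \<in> carrier X" and ab: "\<not> below a b" "\<not> below b a"
  shows "X \<cong> V3"
proof -
  define c where "c = a \<otimes> b"
  have X: "carrier X = {c, a, b}" using carrier_of_incomparable[OF assms] by (simp add: c_def)
  have ca: "below c a" "below c b" using meet_below a b by (simp_all add: c_def)
  have ne: "a \<noteq> b" "c \<noteq> a" "c \<noteq> b" using ab below_refl a ca by auto
  have t: "a \<otimes> a = a" "b \<otimes> b = b" "c \<otimes> c = c" "a \<otimes> b = c" "b \<otimes> a = c"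
    "c \<otimes> a = c" "a \<otimes> c = c" "c \<otimes> b = c" "b \<otimes> c = c"
    using idem m_comm X ca c_def unfolding below_def by (metis insertI1 insertI2)+
  have V3: "{0, 1} \<times> {0, 1} - {(1, 1)} = {(0::nat, 0::nat), (0, 1), (1, 0)}" by auto
  define h :: "'a \<Rightarrow> nat \<times> nat"
    where "h x = (if x = a then (1, 0) else if x = b then (0, 1) else (0, 0))" for x
  have "h \<in> iso X V3"
    using ne by (auto simp: iso_def hom_def bij_betw_def V3_def semigroup_of_def V3 X t h_def)
  then show ?thesis by (rule is_isoI)
qed

end

subsection \<open>Classification\<close>

lemma square_roots_of_unity: "{z::complex. z ^ 2 = 1} = {1, -1}"
  by (auto simp: power2_eq_1_iff)

context supercommutative_regular
begin

lemma iso_cyclic: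
  assumes g: "g \<in> carrier X" "g \<otimes> g \<noteq> g"
  shows "X \<cong> cyclic_C 2 \<or> X \<cong> ordered_union (linear_L 1) (cyclic_C 2)"
proof -
  define e where "e = g \<otimes> g"
  have e: "e \<in> carrier X" using m_closed g by (simp add: e_def)
  have t: "g \<otimes> g = e" "e \<otimes> e = e" "g \<otimes> e = g" "e \<otimes> g = g" "g \<noteq> e"
    using square_idem[OF g(1)] cube[OF g(1)] m_comm[OF g(1) e] g(2) by (auto simp: e_def)
  from g show ?thesis
  proof (rule carrier_with_involution)
    assume X: "carrier X = {g \<otimes> g, g}"
    define h :: "'a \<Rightarrow> complex" where "h x = (if x = g then -1 else 1)" for x
    have "h \<in> iso X (cyclic_C 2)"
      using t(5) t(5)[symmetric] by (auto simp: iso_def hom_def bij_betw_def cyclic_C_def semigroup_of_def square_roots_of_unity X t h_def)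
    then show ?thesis using is_isoI by blast
  next
    fix f assume X: "carrier X = {f, g \<otimes> g, g}" and ne: "f \<noteq> g \<otimes> g" "f \<noteq> g"
      and f: "f \<otimes> f = f" "f \<otimes> (g \<otimes> g) = f" "f \<otimes> g = f"
    have f': "e \<otimes> f = f" "f \<otimes> e = f" "g \<otimes> f = f" "f \<noteq> e" using f m_comm X ne e_def by auto
    define h :: "'a \<Rightarrow> nat + complex"
      where "h x = (if x = f then Inl 0 else if x = g then Inr (-1) else Inr 1)" for x
    have "h \<in> iso X (ordered_union (linear_L 1) (cyclic_C 2))"
      using t(5) t(5)[symmetric] ne(2) f'(4) f'(4)[symmetric] by (auto simp: iso_def hom_def bij_betw_def cyclic_C_def linear_L_def
        ordered_union_def semigroup_of_def square_roots_of_unity X t f f' h_def Plus_def inj_on_def)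
    then show ?thesis using is_isoI by blast
  qed
qed

lemma classification:
  "X \<cong> cyclic_C 2 \<or> X \<cong> ordered_union (linear_L 1) (cyclic_C 2) \<or> X \<cong> V3 \<or> (\<exists>n\<ge>1. X \<cong> linear_L n)"
proof (cases "\<exists>g\<in>carrier X. g \<otimes> g \<noteq> g")
  case True
  then show ?thesis using iso_cyclic by blast
next
  case False
  interpret supercommutative_semilattice X by unfold_locales (use False in blast)
  show ?thesis
  proof (cases "\<forall>x\<in>carrier X. \<forall>y\<in>carrier X. below x y \<or> below y x")
    case True
    then have "X \<cong> linear_L (card (carrier X))" "finite (carrier X)"
      using iso_linear_L finite_of_chain by blast+
    moreover have "1 \<le> card (carrier X)"
      using nonempty calculation(2) by (simp add: Suc_le_eq card_gt_0_iff)
    ultimately show ?thesis by blast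
  next
    case False
    then show ?thesis using iso_V3 by blast
  qed
qed

end

section \<open>Invariance under isomorphism\<close>

lemma isoD:
  assumes "h \<in> iso X Y"
  shows "inj_on h (carrier X)" "h ` carrier X = carrier Y"
    "\<And>x y. x \<in> carrier X \<Longrightarrow> y \<in> carrier X \<Longrightarrow> h (x \<otimes>\<^bsub>X\<^esub> y) = h x \<otimes>\<^bsub>Y\<^esub> h y"
  using assms by (auto simp: iso_def hom_def bij_betw_def)

text \<open>Transports the table condition along the isomorphism, so that it can be checked on the
  explicit model \<open>Y\<close>.\<close>

lemma supercommutative_if_iso_three_elements:
  fixes X (structure)
  assumes X: "carrier_semigroup X" and "X \<cong> Y"
    and Y: "carrier Y = {p, q, r}" "distinct [p, q, r]"
    and comm: "\<And>x y. x \<in> carrier Y \<Longrightarrow> y \<in> carrier Y \<Longrightarrow> x \<otimes>\<^bsub>Y\<^esub> y = y \<otimes>\<^bsub>Y\<^esub> x"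
    and minor: "\<And>E. two_of p q r (\<lambda>a. two_of p q r (\<lambda>b. a \<otimes>\<^bsub>Y\<^esub> b \<in> E)) \<Longrightarrow>
      \<exists>P\<in>{{p, q}, {p, r}, {q, r}}. \<exists>Q\<in>{{p, q}, {p, r}, {q, r}}. \<forall>a\<in>P. \<forall>b\<in>Q. a \<otimes>\<^bsub>Y\<^esub> b \<in> E"
  shows "supercommutative_superextension X"
proof -
  interpret carrier_semigroup X by (fact X)
  obtain h where h: "h \<in> iso X Y" using \<open>X \<cong> Y\<close> unfolding is_iso_def by blast
  note inj = isoD(1)[OF h] and img = isoD(2)[OF h] and mult = isoD(3)[OF h]
  define g where "g = inv_into (carrier X) h"
  have hg: "h (g y) = y" and gX: "g y \<in> carrier X" if "y \<in> carrier Y" for y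
    using that img by (simp_all add: g_def f_inv_into_f inv_into_into)
  have pqr: "p \<in> carrier Y" "q \<in> carrier Y" "r \<in> carrier Y" using Y(1) by auto
  have "x \<in> g ` carrier Y" if "x \<in> carrier X" for x
    using that img inj by (intro image_eqI[of _ _ "h x"]) (auto simp: g_def)
  then have carX: "carrier X = {g p, g q, g r}" using gX Y(1) by auto
  have dist: "distinct [g p, g q, g r]" using Y(2) hg pqr by (simp; metis)
  show ?thesis
  proof (rule supercommutative_three_elements[OF _ carX dist])
    fix x y assume xy: "x \<in> carrier X" "y \<in> carrier X"
    have "h (x \<otimes> y) = h (y \<otimes> x)" using comm mult xy img by (metis imageI)
    then show "x \<otimes> y = y \<otimes> x" using inj_onD[OF inj] m_closed xy by blast
  next
    fix E assume rows: "two_of (g p) (g q) (g r) (\<lambda>a. two_of (g p) (g q) (g r) (\<lambda>b. a \<otimes> b \<in> E))"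
    \<comment> \<open>\<open>E\<close> is cut down to the carrier because \<open>h\<close> is
      injective only there.\<close>
    define F where "F = h ` (E \<inter> carrier X)"
    have F: "a \<otimes>\<^bsub>Y\<^esub> b \<in> F \<longleftrightarrow> g a \<otimes> g b \<in> E" if "a \<in> carrier Y" "b \<in> carrier Y" for a b
    proof -
      have "a \<otimes>\<^bsub>Y\<^esub> b = h (g a \<otimes> g b)" using mult gX hg that by simp
      then show ?thesis
        using inj_on_image_mem_iff[OF inj, of "g a \<otimes> g b" "E \<inter> carrier X"] m_closed gX that
        by (simp add: F_def)
    qed
    have "two_of p q r (\<lambda>a. two_of p q r (\<lambda>b. a \<otimes>\<^bsub>Y\<^esub> b \<in> F))"
      using rows by (simp add: two_of_def F pqr)
    from minor[OF this] obtain P Q where PQ: "P \<in> {{p, q}, {p, r}, {q, r}}"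
      "Q \<in> {{p, q}, {p, r}, {q, r}}" "\<forall>a\<in>P. \<forall>b\<in>Q. a \<otimes>\<^bsub>Y\<^esub> b \<in> F" by blast
    moreover have "P \<subseteq> carrier Y" "Q \<subseteq> carrier Y" using PQ(1,2) Y(1) by auto
    ultimately have "\<forall>a\<in>g ` P. \<forall>b\<in>g ` Q. a \<otimes> b \<in> E" using F by blast
    moreover have "g ` P \<in> {{g p, g q}, {g p, g r}, {g q, g r}}"
      "g ` Q \<in> {{g p, g q}, {g p, g r}, {g q, g r}}" using PQ(1,2) by auto
    ultimately show "\<exists>P\<in>{{g p, g q}, {g p, g r}, {g q, g r}}.
        \<exists>Q\<in>{{g p, g q}, {g p, g r}, {g q, g r}}. \<forall>a\<in>P. \<forall>b\<in>Q. a \<otimes> b \<in> E"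
      by blast
  qed
qed

lemma supercommutative_if_iso_C2:
  fixes X (structure)
  assumes X: "carrier_semigroup X" and iso: "X \<cong> cyclic_C 2"
  shows "supercommutative_superextension X"
proof -
  interpret carrier_semigroup X by (fact X)
  obtain h where h: "h \<in> iso X (cyclic_C 2)" using iso unfolding is_iso_def by blast
  have "card (carrier X) = 2"
    using iso_same_card[OF iso] by (simp add: cyclic_C_def semigroup_of_def square_roots_of_unity)
  then obtain p q where "carrier X = {p, q}" "p \<noteq> q" by (auto simp: card_2_iff)
  moreover have "x \<otimes> y = y \<otimes> x" if "x \<in> carrier X" "y \<in> carrier X" for x y
  proof (rule inj_onD[OF isoD(1)[OF h]])
    show "h (x \<otimes> y) = h (y \<otimes> x)"
      using isoD(3)[OF h] that by (simp add: cyclic_C_def semigroup_of_def mult.commute)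
  qed (use m_closed that in auto)
  ultimately show ?thesis by (intro supercommutative_two_elements) auto
qed

lemma supercommutative_if_iso_linear_L:
  fixes X (structure)
  assumes X: "carrier_semigroup X" and iso: "X \<cong> linear_L n"
  shows "supercommutative_superextension X"
proof -
  interpret carrier_semigroup X by (fact X)
  obtain h where h: "h \<in> iso X (linear_L n)" using iso unfolding is_iso_def by blast
  show ?thesis
  proof (rule supercommutative_finite_chain[OF isoD(1)[OF h]])
    show "finite (carrier X)" using iso_finite[OF iso] by (simp add: linear_L_def semigroup_of_def)
    show "h (x \<otimes> y) = min (h x) (h y)" if "x \<in> carrier X" "y \<in> carrier X" for x y
      using isoD(3)[OF h that] by (simp add: linear_L_def semigroup_of_def)
  qed (fact m_closed)
qed

text \<open>Two rows with two marked cells force the zero to be marked, and the minor with rows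
  \<open>(0, 0)\<close>, \<open>(0, 1)\<close> and columns \<open>(0, 0)\<close>,
  \<open>(1, 0)\<close> is constantly zero.\<close>

lemma supercommutative_if_iso_V3:
  assumes X: "carrier_semigroup X" and iso: "X \<cong> V3"
  shows "supercommutative_superextension X"
proof (rule supercommutative_if_iso_three_elements[OF X iso])
  show "carrier V3 = {(0, 0), (0, 1), (1, 0)}" by (auto simp: V3_def semigroup_of_def)
  show "x \<otimes>\<^bsub>V3\<^esub> y = y \<otimes>\<^bsub>V3\<^esub> x" for x y
    by (cases x; cases y) (simp add: V3_def semigroup_of_def min.commute)
qed (auto simp: V3_def semigroup_of_def two_of_def)

text \<open>If the zero \<open>Inl 0\<close> is unmarked, both units must be marked and form a
  minor; if it is marked, so is some unit, and a minor with three zeros and that unit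
  exists.\<close>

lemma supercommutative_if_iso_L1_C2:
  assumes X: "carrier_semigroup X" and iso: "X \<cong> ordered_union (linear_L 1) (cyclic_C 2)"
  shows "supercommutative_superextension X"
proof (rule supercommutative_if_iso_three_elements[OF X iso])
  let ?Y = "ordered_union (linear_L 1) (cyclic_C 2)"
  show car: "carrier ?Y = {Inl 0, Inr 1, Inr (-1)}"
    by (auto simp: ordered_union_def linear_L_def cyclic_C_def semigroup_of_def square_roots_of_unity)
  show "x \<otimes>\<^bsub>?Y\<^esub> y = y \<otimes>\<^bsub>?Y\<^esub> x" if "x \<in> carrier ?Y" "y \<in> carrier ?Y" for x y
    using that unfolding car
    by (auto simp: ordered_union_def linear_L_def cyclic_C_def semigroup_of_def)
qed (auto simp: ordered_union_def linear_L_def cyclic_C_def semigroup_of_def two_of_def)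

theorem theorem10p2:
  fixes X :: "('a, 'm) monoid_scheme"
  assumes "regular_carrier_semigroup X"
  shows "supercommutative_superextension X \<longleftrightarrow>
    X \<cong> cyclic_C 2 \<or>
    X \<cong> ordered_union (linear_L 1) (cyclic_C 2) \<or>
    X \<cong> V3 \<or>
    (\<exists>n \<ge> 1. X \<cong> linear_L n)"
proof
  assume "supercommutative_superextension X"
  then have "supercommutative_regular X"
    using assms by (simp add: supercommutative_regular_def supercommutative_regular_axioms_def)
  then show "X \<cong> cyclic_C 2 \<or> X \<cong> ordered_union (linear_L 1) (cyclic_C 2) \<or> X \<cong> V3 \<or>
      (\<exists>n\<ge>1. X \<cong> linear_L n)"
    by (rule supercommutative_regular.classification)
next
  have "carrier_semigroup X" using assms by (simp add: regular_carrier_semigroup_def)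
  moreover assume "X \<cong> cyclic_C 2 \<or> X \<cong> ordered_union (linear_L 1) (cyclic_C 2) \<or> X \<cong> V3 \<or>
      (\<exists>n\<ge>1. X \<cong> linear_L n)"
  ultimately show "supercommutative_superextension X"
    using supercommutative_if_iso_C2 supercommutative_if_iso_L1_C2 supercommutative_if_iso_V3
      supercommutative_if_iso_linear_L by blast
qed

end
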